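(* For any non-empty finite simple graph $G$, the following are equivalent: (i) $J(G)=G$; (ii) $J^k(G)=G$ for some integer $k\ge 1$; (iii) $G$ is $C_5$ or the net graph $N$.
   Context: The jump graph $J(G)$ of a graph $G$ has vertex set $E(G)$, and two vertices of $J(G)$ are adjacent iff the corresponding edges of $G$ share no endpoint. Set $J^0(G)=G$ and $J^k(G)=J(J^{k-1}(G))$. $C_5$ is the 5-cycle; the net graph $N$ is a triangle with one pendant edge attached at each of its three vertices. Equality of graphs means isomorphism, where graphs differing only by isolated vertices are regarded as equal. *)

theory Defs
  imports Main "HOL-Library.FSet"
begin

record 'a ugraph =
  vertices :: "'a set"
  edges :: "'a set set"

definition finite_simple_graph :: "'a ugraph \<Rightarrow> bool" where
  "finite_simple_graph G \<longleftrightarrow>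
     finite (vertices G) \<and> (\<forall>e \<in> edges G. e \<subseteq> vertices G \<and> card e = 2)"

definition graph_iso :: "'a ugraph \<Rightarrow> 'b ugraph \<Rightarrow> bool" where
  "graph_iso G H \<longleftrightarrow>
     (\<exists>f. bij_betw f (vertices G) (vertices H) \<and>
          (\<forall>u \<in> vertices G. \<forall>v \<in> vertices G. {u, v} \<in> edges G \<longleftrightarrow> {f u, f v} \<in> edges H))"

definition del_isolated :: "'a ugraph \<Rightarrow> 'a ugraph" where
  "del_isolated G = \<lparr>vertices = {v \<in> vertices G. \<exists>e \<in> edges G. v \<in> e}, edges = edges G\<rparr>"

text \<open>Equality of graphs: isomorphism, disregarding isolated vertices.\<close>

definition graph_eq :: "'a ugraph \<Rightarrow> 'b ugraph \<Rightarrow> bool" (infix "\<simeq>\<^sub>g" 50) where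
  "G \<simeq>\<^sub>g H \<longleftrightarrow> graph_iso (del_isolated G) (del_isolated H)"

text \<open>In a simple graph two edges without a common endpoint are automatically distinct.\<close>

definition jump_graph :: "'a ugraph \<Rightarrow> 'a set ugraph" where
  "jump_graph G =
     \<lparr>vertices = edges G,
      edges = {{e, f} | e f. e \<in> edges G \<and> f \<in> edges G \<and> e \<inter> f = {}}\<rparr>"

text \<open>
  The vertices of the jump graph live in a different type from those of the graph itself.
  To iterate, vertices are represented in a single type: an original vertex, or an edge
  given as the finite set of its endpoints.
\<close>

datatype 'a jvertex = Orig 'a | Edge "'a jvertex fset"

definition relabel :: "('a \<Rightarrow> 'b) \<Rightarrow> 'a ugraph \<Rightarrow> 'b ugraph" where
  "relabel f G = \<lparr>vertices = f ` vertices G, edges = (\<lambda>e. f ` e) ` edges G\<rparr>"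

primrec jump_iter :: "nat \<Rightarrow> 'a ugraph \<Rightarrow> 'a jvertex ugraph" where
  "jump_iter 0 G = relabel Orig G"
| "jump_iter (Suc k) G = relabel (\<lambda>e. Edge (Abs_fset e)) (jump_graph (jump_iter k G))"

definition C5 :: "nat ugraph" where
  "C5 = \<lparr>vertices = {0, 1, 2, 3, 4},
         edges = {{0, 1}, {1, 2}, {2, 3}, {3, 4}, {4, 0}}\<rparr>"

definition net_graph :: "nat ugraph" where
  "net_graph = \<lparr>vertices = {0, 1, 2, 3, 4, 5},
                edges = {{0, 1}, {1, 2}, {2, 0}, {0, 3}, {1, 4}, {2, 5}}\<rparr>"

text \<open>The relabellings used in the iteration are isomorphisms.\<close>

lemma finite_simple_graph_jump:
  assumes "finite_simple_graph G"
  shows "finite_simple_graph (jump_graph G)"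
proof -
  have "edges G \<subseteq> Pow (vertices G)" "finite (vertices G)"
    using assms by (auto simp: finite_simple_graph_def)
  then have "finite (edges G)" by (meson finite_Pow_iff finite_subset)
  moreover have "e \<noteq> f" if "e \<in> edges G" "e \<inter> f = {}" for e f
    using that assms by (auto simp: finite_simple_graph_def)
  then have "card {e, f} = 2" if "e \<in> edges G" "e \<inter> f = {}" for e f
    using that by (simp add: card_insert_if)
  ultimately show ?thesis
    unfolding finite_simple_graph_def jump_graph_def by auto
qed

lemma finite_simple_graph_relabel:
  assumes "finite_simple_graph G" "inj_on f (vertices G)"
  shows "finite_simple_graph (relabel f G)"
proof -
  have "f ` e \<subseteq> f ` vertices G \<and> card (f ` e) = 2" if "e \<in> edges G" for e
  proof -
    from that assms(1) have "e \<subseteq> vertices G" "card e = 2"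
      by (simp_all add: finite_simple_graph_def)
    then show ?thesis
      using card_image[OF inj_on_subset[OF assms(2)]] by (simp add: image_mono)
  qed
  then show ?thesis
    using assms(1) by (simp add: finite_simple_graph_def relabel_def)
qed

lemma graph_iso_relabel:
  assumes "finite_simple_graph G" "inj_on f (vertices G)"
  shows "graph_iso G (relabel f G)"
  unfolding graph_iso_def
proof (intro exI conjI ballI)
  show "bij_betw f (vertices G) (vertices (relabel f G))"
    using assms(2) by (simp add: relabel_def bij_betw_def)
  fix u v assume uv: "u \<in> vertices G" "v \<in> vertices G"
  show "{u, v} \<in> edges G \<longleftrightarrow> {f u, f v} \<in> edges (relabel f G)"
  proof
    assume "{f u, f v} \<in> edges (relabel f G)"
    then have "f ` {u, v} \<in> (\<lambda>e. f ` e) ` edges G" by (simp add: relabel_def)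
    then obtain e where e: "e \<in> edges G" "f ` {u, v} = f ` e" by (rule imageE)
    then have "e \<subseteq> vertices G" using assms(1) by (auto simp: finite_simple_graph_def)
    then have "{u, v} = e"
      using inj_on_image_eq_iff[OF assms(2), of "{u, v}" e] e(2) uv by simp
    then show "{u, v} \<in> edges G" using e by simp
  next
    assume "{u, v} \<in> edges G"
    then have "f ` {u, v} \<in> (\<lambda>e. f ` e) ` edges G" by (rule imageI)
    then show "{f u, f v} \<in> edges (relabel f G)" by (simp add: relabel_def)
  qed
qed

lemma inj_on_Edge_Abs_fset:
  assumes "finite_simple_graph G"
  shows "inj_on (\<lambda>e. Edge (Abs_fset e)) (vertices (jump_graph G))"
proof (rule inj_onI)
  fix e f assume "e \<in> vertices (jump_graph G)" "f \<in> vertices (jump_graph G)"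
    and eq: "Edge (Abs_fset e) = Edge (Abs_fset f)"
  then have "finite e" "finite f"
    using assms by (simp_all add: finite_simple_graph_def jump_graph_def card_ge_0_finite)
  then show "e = f" using eq by (simp add: Abs_fset_inject)
qed

lemma inj_on_Orig: "inj_on Orig A"
  by (simp add: inj_on_def)

lemma finite_simple_graph_jump_iter:
  "finite_simple_graph G \<Longrightarrow> finite_simple_graph (jump_iter k G)"
  by (induction k)
     (simp_all add: finite_simple_graph_relabel inj_on_Orig finite_simple_graph_jump
       inj_on_Edge_Abs_fset)

lemma graph_iso_jump_iter_0:
  "finite_simple_graph G \<Longrightarrow> graph_iso G (jump_iter 0 G)"
  by (simp add: graph_iso_relabel inj_on_Orig)

lemma graph_iso_jump_iter_Suc:
  "finite_simple_graph G \<Longrightarrow> graph_iso (jump_graph (jump_iter k G)) (jump_iter (Suc k) G)"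
  by (simp add: graph_iso_relabel finite_simple_graph_jump inj_on_Edge_Abs_fset
      finite_simple_graph_jump_iter)

end

theory Submission
  imports Defs
begin

text \<open>
  Suppose that the iterates of \<open>G\<close> are periodic. Both \<open>C\<^sub>5\<close> and the net \<open>N\<close> are fixed by \<open>J\<close>, and
  \<open>J\<close> is monotone for the subgraph relation. If an iterate contains one of them, so do all later
  ones; every edge outside a copy of \<open>C\<^sub>5\<close> or \<open>N\<close> is disjoint from some edge of the copy, so the number
  of edges never decreases, and it increases within two steps unless the iterate is that copy. By
  periodicity \<open>G\<close> is then \<open>C\<^sub>5\<close> or \<open>N\<close>.

  It remains to see that a graph none of whose iterates contains \<open>C\<^sub>5\<close> or \<open>N\<close> dies out. If \<open>J(J(G))\<close>
  has an edge, then \<open>G\<close> contains two pairs of disjoint edges, and hence one of the six graphs with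
  four edges that are a 4-cycle or a disjoint union of paths. Adding edges one at a time to these,
  one meets up to isomorphism only 22 graphs that do not lead to \<open>C\<^sub>5\<close> or \<open>N\<close>; they have at most six
  edges, and their sixth iterate is empty.
\<close>

subsection \<open>Edge sets up to isomorphism\<close>

text \<open>Isolated vertices being disregarded, a graph is given by its edge set alone, with
  \<open>\<Union>A\<close> as vertex set. An edge of \<open>A\<close> that meets every edge is
  thereby no vertex of the graph \<open>jmp A\<close>.\<close>

definition jmp :: "'a set set \<Rightarrow> 'a set set set" where
  "jmp A = {{e, f} | e f. e \<in> A \<and> f \<in> A \<and> e \<inter> f = {}}"

definition embeds :: "'a set set \<Rightarrow> 'b set set \<Rightarrow> bool" where
  "embeds A B \<longleftrightarrow> (\<exists>f. inj_on f (\<Union>A) \<and> (`) f ` A \<subseteq> B)"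

definition isom :: "'a set set \<Rightarrow> 'b set set \<Rightarrow> bool" where
  "isom A B \<longleftrightarrow> (\<exists>f. inj_on f (\<Union>A) \<and> (`) f ` A = B)"

definition two_uniform :: "'a set set \<Rightarrow> bool" where
  "two_uniform A \<longleftrightarrow> finite A \<and> (\<forall>e\<in>A. card e = 2)"

lemma isom_imp_embeds: "isom A B \<Longrightarrow> embeds A B"
  by (auto simp: isom_def embeds_def)

lemma isom_refl: "isom A A"
  unfolding isom_def by (rule exI[of _ "\<lambda>x. x"]) auto

lemma isom_sym:
  assumes "isom A B"
  shows "isom B A"
proof -
  obtain f where f: "inj_on f (\<Union>A)" "(`) f ` A = B"
    using assms by (auto simp: isom_def)
  define g where "g = inv_into (\<Union>A) f"
  have "\<Union>B = f ` \<Union>A"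
    using f(2) by auto
  then have "inj_on g (\<Union>B)"
    unfolding g_def by (simp add: inj_on_inv_into)
  moreover have "g ` f ` e = e" if "e \<in> A" for e
    unfolding g_def using f(1) that by (intro inv_into_image_cancel) auto
  then have "(`) g ` B = A"
    using f(2) by (auto simp: image_iff)
  ultimately show ?thesis
    unfolding isom_def by blast
qed

lemma embeds_trans:
  assumes "embeds A B" "embeds B C"
  shows "embeds A C"
proof -
  obtain f g where f: "inj_on f (\<Union>A)" "(`) f ` A \<subseteq> B"
    and g: "inj_on g (\<Union>B)" "(`) g ` B \<subseteq> C"
    using assms by (auto simp: embeds_def)
  have "f ` \<Union>A \<subseteq> \<Union>B"
    using f(2) by blast
  then have "inj_on (g \<circ> f) (\<Union>A)"
    using f(1) g(1) by (meson comp_inj_on inj_on_subset)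
  moreover have "(`) (g \<circ> f) ` A = (`) g ` (`) f ` A"
    by (simp add: image_image image_comp)
  then have "(`) (g \<circ> f) ` A \<subseteq> C"
    using image_mono[OF f(2), of "(`) g"] g(2) by simp
  ultimately show ?thesis
    unfolding embeds_def by blast
qed

lemma isom_trans:
  assumes "isom A B" "isom B C"
  shows "isom A C"
proof -
  obtain f g where f: "inj_on f (\<Union>A)" "(`) f ` A = B"
    and g: "inj_on g (\<Union>B)" "(`) g ` B = C"
    using assms by (auto simp: isom_def)
  have "f ` \<Union>A = \<Union>B"
    using f(2) by auto
  then have "inj_on (g \<circ> f) (\<Union>A)"
    using f(1) g(1) by (simp add: comp_inj_on)
  moreover have "(`) (g \<circ> f) ` A = C"
    unfolding f(2)[symmetric] g(2)[symmetric] by (simp add: image_image image_comp)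
  ultimately show ?thesis
    unfolding isom_def by blast
qed

lemma inj_on_image_edges: "inj_on f (\<Union>A) \<Longrightarrow> inj_on ((`) f) A"
  by (rule inj_onI) (simp add: inj_on_image_eq_iff Union_upper)

lemma isom_card: "isom A B \<Longrightarrow> card A = card B"
  by (auto simp: isom_def card_image inj_on_image_edges)

lemma embeds_card_isom:
  assumes "embeds A B" "finite B" "card B \<le> card A"
  shows "isom A B"
proof -
  obtain f where f: "inj_on f (\<Union>A)" "(`) f ` A \<subseteq> B"
    using assms by (auto simp: embeds_def)
  have "card ((`) f ` A) = card A"
    by (simp add: card_image f(1) inj_on_image_edges)
  then have "(`) f ` A = B"
    using assms(2,3) card_seteq f(2) by metis
  then show ?thesis
    using f(1) by (auto simp: isom_def)
qed

lemma Union_jmp_subset: "\<Union>(jmp A) \<subseteq> A"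
  by (auto simp: jmp_def)

lemma jmp_mono: "A \<subseteq> B \<Longrightarrow> jmp A \<subseteq> jmp B"
  by (auto simp: jmp_def)

text \<open>An injective vertex map preserves and reflects disjointness of edges. On the vertices of
  the jump graph it acts by taking images of edges, hence the images one level up.\<close>

lemma jmp_image:
  assumes "inj_on f (\<Union>A)"
  shows "jmp ((`) f ` A) = (`) ((`) f) ` jmp A"
proof -
  have dis: "f ` d \<inter> f ` e = {} \<longleftrightarrow> d \<inter> e = {}" if "d \<in> A" "e \<in> A" for d e
    using assms that by (metis Union_upper image_is_empty inj_on_image_Int)
  show ?thesis
  proof (intro equalityI subsetI)
    fix x assume "x \<in> jmp ((`) f ` A)"
    then obtain d e where "d \<in> A" "e \<in> A" "x = {f ` d, f ` e}" "f ` d \<inter> f ` e = {}"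
      by (auto simp: jmp_def)
    then have "x = (`) f ` {d, e}" "{d, e} \<in> jmp A"
      using dis by (auto simp: jmp_def)
    then show "x \<in> (`) ((`) f) ` jmp A"
      by blast
  next
    fix x assume "x \<in> (`) ((`) f) ` jmp A"
    then obtain d e where de: "d \<in> A" "e \<in> A" "d \<inter> e = {}" "x = {f ` d, f ` e}"
      by (auto simp: jmp_def)
    then have "f ` d \<in> (`) f ` A" "f ` e \<in> (`) f ` A" "f ` d \<inter> f ` e = {}"
      using dis by simp_all
    then show "x \<in> jmp ((`) f ` A)"
      unfolding jmp_def de(4) mem_Collect_eq by (intro exI conjI) (rule refl)
  qed
qed

lemma inj_on_image_jmp: "inj_on f (\<Union>A) \<Longrightarrow> inj_on ((`) f) (\<Union>(jmp A))"
  by (rule inj_on_subset[OF inj_on_image_edges Union_jmp_subset])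

lemma embeds_jmp:
  assumes "embeds A B"
  shows "embeds (jmp A) (jmp B)"
proof -
  obtain f where f: "inj_on f (\<Union>A)" "(`) f ` A \<subseteq> B"
    using assms by (auto simp: embeds_def)
  have "(`) ((`) f) ` jmp A \<subseteq> jmp B"
    using jmp_mono[OF f(2)] by (simp add: jmp_image[OF f(1)])
  then show ?thesis
    unfolding embeds_def using inj_on_image_jmp[OF f(1)] by blast
qed

lemma isom_jmp:
  assumes "isom A B"
  shows "isom (jmp A) (jmp B)"
proof -
  obtain f where f: "inj_on f (\<Union>A)" "(`) f ` A = B"
    using assms by (auto simp: isom_def)
  then have "(`) ((`) f) ` jmp A = jmp B"
    using jmp_image[OF f(1)] by simp
  then show ?thesis
    unfolding isom_def using inj_on_image_jmp[OF f(1)] by blast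
qed

lemma two_uniform_jmp:
  assumes "two_uniform A"
  shows "two_uniform (jmp A)"
proof -
  have "jmp A \<subseteq> Pow A"
    by (auto simp: jmp_def)
  then have "finite (jmp A)"
    using assms finite_subset by (auto simp: two_uniform_def)
  moreover have "card {d, e} = 2" if "d \<in> A" "d \<inter> e = {}" for d e
    using that assms by (auto simp: two_uniform_def card_insert_if)
  ultimately show ?thesis
    by (auto simp: two_uniform_def jmp_def)
qed

lemma two_uniform_edges:
  assumes "finite_simple_graph G"
  shows "two_uniform (edges G)"
proof -
  have "edges G \<subseteq> Pow (vertices G)"
    using assms by (auto simp: finite_simple_graph_def)
  then have "finite (edges G)"
    using assms finite_subset by (auto simp: finite_simple_graph_def)
  then show ?thesis
    using assms by (simp add: finite_simple_graph_def two_uniform_def)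
qed

text \<open>Without isolated vertices the vertex set is the union of the edges, and every edge is a
  pair; so preserving adjacency in both directions amounts to carrying one edge set onto the
  other.\<close>

lemma graph_eq_iff_isom:
  fixes G :: "'a ugraph" and H :: "'b ugraph"
  assumes "finite_simple_graph G" "finite_simple_graph H"
  shows "G \<simeq>\<^sub>g H \<longleftrightarrow> isom (edges G) (edges H)"
proof -
  have "{v \<in> vertices G. \<exists>e\<in>edges G. v \<in> e} = \<Union>(edges G)"
    "{v \<in> vertices H. \<exists>e\<in>edges H. v \<in> e} = \<Union>(edges H)"
    using assms by (auto simp: finite_simple_graph_def)
  then have eq: "G \<simeq>\<^sub>g H \<longleftrightarrow> (\<exists>f. bij_betw f (\<Union>(edges G)) (\<Union>(edges H)) \<and>
    (\<forall>u\<in>\<Union>(edges G). \<forall>v\<in>\<Union>(edges G). {u, v} \<in> edges G \<longleftrightarrow> {f u, f v} \<in> edges H))"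
    by (simp add: graph_eq_def graph_iso_def del_isolated_def)
  have fwd: "(`) f ` edges G = edges H"
    if f: "bij_betw f (\<Union>(edges G)) (\<Union>(edges H))"
      "\<forall>u\<in>\<Union>(edges G). \<forall>v\<in>\<Union>(edges G). {u, v} \<in> edges G \<longleftrightarrow> {f u, f v} \<in> edges H" for f
  proof (intro equalityI subsetI)
    fix e assume "e \<in> (`) f ` edges G"
    then obtain d where d: "d \<in> edges G" "e = f ` d"
      by auto
    then obtain u v where uv: "d = {u, v}"
      using assms(1) by (metis card_2_iff finite_simple_graph_def)
    then have "u \<in> \<Union>(edges G)" "v \<in> \<Union>(edges G)"
      using d by auto
    then show "e \<in> edges H"
      using d uv f(2) by simp
  next
    fix e assume e: "e \<in> edges H"
    then obtain x y where xy: "e = {x, y}"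
      using assms(2) by (metis card_2_iff finite_simple_graph_def)
    then have "x \<in> f ` \<Union>(edges G)" "y \<in> f ` \<Union>(edges G)"
      using e f(1) by (auto simp: bij_betw_def)
    then obtain u v where uv: "u \<in> \<Union>(edges G)" "v \<in> \<Union>(edges G)" "x = f u" "y = f v"
      by blast
    then have "{u, v} \<in> edges G"
      using e xy f(2) by blast
    then show "e \<in> (`) f ` edges G"
      using uv xy by (intro image_eqI[of _ _ "{u, v}"]) auto
  qed
  have bwd: "bij_betw f (\<Union>(edges G)) (\<Union>(edges H)) \<and>
    (\<forall>u\<in>\<Union>(edges G). \<forall>v\<in>\<Union>(edges G). {u, v} \<in> edges G \<longleftrightarrow> {f u, f v} \<in> edges H)"
    if f: "inj_on f (\<Union>(edges G))" "(`) f ` edges G = edges H" for f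
  proof (intro conjI ballI iffI)
    show "bij_betw f (\<Union>(edges G)) (\<Union>(edges H))"
      using f unfolding bij_betw_def f(2)[symmetric] by auto
    fix u v assume uv: "u \<in> \<Union>(edges G)" "v \<in> \<Union>(edges G)"
    show "{f u, f v} \<in> edges H" if "{u, v} \<in> edges G"
      using that unfolding f(2)[symmetric] by (intro image_eqI[of _ _ "{u, v}"]) auto
    assume "{f u, f v} \<in> edges H"
    then obtain e where e: "e \<in> edges G" "f ` e = f ` {u, v}"
      unfolding f(2)[symmetric] by auto
    then have "e = {u, v}"
      using uv inj_on_image_eq_iff[OF f(1), of e "{u, v}"] by auto
    then show "{u, v} \<in> edges G"
      using e by simp
  qed
  show ?thesis
  proof
    assume "G \<simeq>\<^sub>g H"
    then obtain f where f: "bij_betw f (\<Union>(edges G)) (\<Union>(edges H))"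
      "\<forall>u\<in>\<Union>(edges G). \<forall>v\<in>\<Union>(edges G). {u, v} \<in> edges G \<longleftrightarrow> {f u, f v} \<in> edges H"
      unfolding eq by (elim exE conjE)
    show "isom (edges G) (edges H)"
      unfolding isom_def using fwd[OF f] bij_betw_imp_inj_on[OF f(1)] by (intro exI conjI)
  next
    assume "isom (edges G) (edges H)"
    then obtain f where "inj_on f (\<Union>(edges G))" "(`) f ` edges G = edges H"
      unfolding isom_def by (elim exE conjE)
    then show "G \<simeq>\<^sub>g H"
      unfolding eq by (intro exI) (rule bwd)
  qed
qed

subsection \<open>Growth around a fixed subgraph\<close>

lemma jmpI: "d \<in> A \<Longrightarrow> e \<in> A \<Longrightarrow> d \<inter> e = {} \<Longrightarrow> {d, e} \<in> jmp A"
  unfolding jmp_def mem_Collect_eq by (intro exI conjI) (rule refl)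

text \<open>Each \<open>d\<close> outside \<open>C\<close> contributes a pair
  \<open>{d, g d}\<close> with \<open>g d\<close> in \<open>C\<close>. These pairs are distinct and
  lie outside \<open>jmp C\<close>. An edge \<open>d\<close> with two disjoint partners in
  \<open>C\<close> contributes a further pair.\<close>

lemma card_le_card_jmp:
  assumes "two_uniform A" "C \<subseteq> A" "card C \<le> card (jmp C)"
    and "\<forall>d\<in>A - C. \<exists>e\<in>C. d \<inter> e = {}"
  shows "card A \<le> card (jmp A)"
    and "\<lbrakk>d \<in> A - C; e \<in> C; e' \<in> C; e \<noteq> e'; d \<inter> e = {}; d \<inter> e' = {}\<rbrakk> \<Longrightarrow> card A < card (jmp A)"
proof -
  obtain g where g: "\<And>d. d \<in> A - C \<Longrightarrow> g d \<in> C \<and> d \<inter> g d = {}"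
    using assms(4) by metis
  have fin: "finite A" "finite C" "finite (jmp A)" "finite (jmp C)"
    using assms(1,2) two_uniform_jmp[OF assms(1)] finite_subset[OF jmp_mono[OF assms(2)]]
    by (auto simp: two_uniform_def finite_subset)
  define D where "D = (\<lambda>d. {d, g d}) ` (A - C)"
  \<comment> \<open>\<open>d\<close> is the only element of \<open>{d, g d}\<close> outside
    \<open>C\<close>, so the pair determines it.\<close>
  have "inj_on (\<lambda>d. {d, g d}) (A - C)"
    by (rule inj_onI) (metis DiffD2 doubleton_eq_iff g)
  then have "card D = card A - card C"
    using fin assms(2) by (simp add: D_def card_image card_Diff_subset)
  moreover have "jmp C \<inter> D = {}"
    using Union_jmp_subset[of C] by (auto simp: D_def)
  moreover have "card C \<le> card A"
    using fin assms(2) by (simp add: card_mono)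
  ultimately have card: "card A \<le> card (jmp C \<union> D)"
    using fin assms(3) by (simp add: card_Un_disjoint D_def)
  have "D \<subseteq> jmp A"
    using g assms(2) by (auto simp: D_def intro!: jmpI)
  then have sub: "jmp C \<union> D \<subseteq> jmp A"
    using jmp_mono[OF assms(2)] by simp
  show "card A \<le> card (jmp A)"
    using card card_mono[OF fin(3) sub] by simp
  assume d: "d \<in> A - C" "e \<in> C" "e' \<in> C" "e \<noteq> e'" "d \<inter> e = {}" "d \<inter> e' = {}"
  \<comment> \<open>Of the two given partners at least one differs from the chosen
    \<open>g d\<close>.\<close>
  obtain c where c: "c \<in> C" "d \<inter> c = {}" "c \<noteq> g d"
    using d by metis
  have "{d, c} \<in> jmp A"
    using d c assms(2) by (intro jmpI) auto
  moreover have "{d, c} \<notin> jmp C"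
    using d(1) Union_jmp_subset[of C] by auto
  moreover have "{d, c} \<notin> D"
    using d(1) c by (auto simp: D_def doubleton_eq_iff)
  ultimately have "jmp C \<union> D \<subset> jmp A"
    using sub by blast
  then show "card A < card (jmp A)"
    using card psubset_card_mono[OF fin(3), of "jmp C \<union> D"] by simp
qed

definition cycle5 :: "'a \<Rightarrow> 'a \<Rightarrow> 'a \<Rightarrow> 'a \<Rightarrow> 'a \<Rightarrow> 'a set set" where
  "cycle5 a b c d e = {{a, b}, {b, c}, {c, d}, {d, e}, {a, e}}"

definition net6 :: "'a \<Rightarrow> 'a \<Rightarrow> 'a \<Rightarrow> 'a \<Rightarrow> 'a \<Rightarrow> 'a \<Rightarrow> 'a set set" where
  "net6 a b c x y z = {{a, b}, {b, c}, {a, c}, {a, x}, {b, y}, {c, z}}"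

text \<open>Each vertex of the cycle lies on two of its five edges. A chord meets four of them,
  leaving one; a pair with at most one vertex on the cycle meets at most two, leaving at least
  three.\<close>

lemma pair_avoiding_cycle5:
  assumes "distinct [a, b, c, d, e]" "card f = 2" "f \<notin> cycle5 a b c d e"
  shows "\<exists>g\<in>cycle5 a b c d e. f \<inter> g = {}"
    and "\<not> f \<subseteq> {a, b, c, d, e} \<Longrightarrow>
      \<exists>g\<in>cycle5 a b c d e. \<exists>h\<in>cycle5 a b c d e. g \<noteq> h \<and> f \<inter> g = {} \<and> f \<inter> h = {}"
proof -
  obtain u v where f: "f = {u, v}" "u \<noteq> v"
    using assms(2) by (auto simp: card_2_iff)
  show "\<exists>g\<in>cycle5 a b c d e. f \<inter> g = {}"
    using assms(1,3) f(2) unfolding f(1) cycle5_def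
    by (cases "u \<in> {a, b, c, d, e}"; cases "v \<in> {a, b, c, d, e}")
       (auto simp: doubleton_eq_iff)
  assume "\<not> f \<subseteq> {a, b, c, d, e}"
  then have "u \<notin> {a, b, c, d, e} \<or> v \<notin> {a, b, c, d, e}"
    unfolding f(1) by simp
  \<comment> \<open>With an endpoint off the cycle, the pair meets it in at most one vertex, called
    \<open>w\<close> below, and only \<open>w\<close> has to be avoided.\<close>
  then have "f \<inter> {a, b, c, d, e} \<subseteq> {v} \<or> f \<inter> {a, b, c, d, e} \<subseteq> {u}"
    unfolding f(1) by fast
  then obtain w where w: "f \<inter> {a, b, c, d, e} \<subseteq> {w}"
    by (elim disjE)
  have rev: "distinct [e, d, c, b, a]"
    using assms(1) by auto
  have "w = a \<or> w = b \<or> w = c \<or> w = d \<or> w = e \<or> w \<notin> {a, b, c, d, e}"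
    by blast
  then have "\<exists>g\<in>cycle5 a b c d e. \<exists>h\<in>cycle5 a b c d e. g \<noteq> h \<and> w \<notin> g \<and> w \<notin> h"
    using assms(1) rev unfolding cycle5_def by (elim disjE) (simp_all add: doubleton_eq_iff)
  moreover have "f \<inter> g = {}" if "g \<in> cycle5 a b c d e" "w \<notin> g" for g
  proof -
    have "g \<subseteq> {a, b, c, d, e}"
      using that(1) unfolding cycle5_def by (elim insertE emptyE) simp_all
    then show ?thesis
      using w that(2) by fast
  qed
  ultimately show "\<exists>g\<in>cycle5 a b c d e. \<exists>h\<in>cycle5 a b c d e. g \<noteq> h \<and> f \<inter> g = {} \<and> f \<inter> h = {}"
    by meson
qed

text \<open>Two triangle vertices form an edge of the net, so a pair outside the net has at most one
  of them. Triangle vertices lie on three edges and pendant ones on one, so at most four of the six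
  edges are met.\<close>

lemma pair_avoiding_net6:
  assumes "distinct [a, b, c, x, y, z]" "card f = 2" "f \<notin> net6 a b c x y z"
  shows "\<exists>g\<in>net6 a b c x y z. \<exists>h\<in>net6 a b c x y z. g \<noteq> h \<and> f \<inter> g = {} \<and> f \<inter> h = {}"
proof -
  obtain u v where f: "f = {u, v}" "u \<noteq> v"
    using assms(2) by (auto simp: card_2_iff)
  have rev: "distinct [z, y, x, c, b, a]"
    using assms(1) by auto
  have cases: "w = a \<or> w = b \<or> w = c \<or> w = x \<or> w = y \<or> w = z \<or> w \<notin> {a, b, c, x, y, z}" for w
    by blast
  show ?thesis
    using cases[of u] cases[of v] assms(1,3) rev f(2) unfolding f(1) net6_def
    by (elim disjE) (simp_all add: doubleton_eq_iff)
qed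

subsection \<open>Edge lists\<close>

definition edge_set :: "(nat \<times> nat) list \<Rightarrow> nat set set" where
  "edge_set E = (\<lambda>(a, b). {a, b}) ` set E"

text \<open>With the smaller endpoint first each edge has one representation, so a list without
  repetitions has as many entries as its edge set.\<close>

definition proper :: "(nat \<times> nat) list \<Rightarrow> bool" where
  "proper E \<longleftrightarrow> distinct E \<and> (\<forall>(a, b)\<in>set E. a < b)"

lemma edge_set_simps [simp]:
  "edge_set [] = {}"
  "edge_set ((a, b) # E) = insert {a, b} (edge_set E)"
  by (simp_all add: edge_set_def)

lemma finite_edge_set [simp]: "finite (edge_set E)"
  by (simp add: edge_set_def)

lemma inj_on_pair_set:
  assumes "proper E"
  shows "inj_on (\<lambda>(a, b). {a, b}) (set E)"
proof -
  have "(a, b) = (c, d)" if "(a, b) \<in> set E" "(c, d) \<in> set E" "{a, b} = {c, d}" for a b c d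
  proof -
    have "a < b" "c < d"
      using assms that by (auto simp: proper_def)
    then show ?thesis
      using that(3) by (auto simp: doubleton_eq_iff)
  qed
  then show ?thesis
    by (intro inj_onI) (simp split: prod.splits)
qed

lemma card_edge_set: "proper E \<Longrightarrow> card (edge_set E) = length E"
  by (simp add: edge_set_def card_image inj_on_pair_set) (simp add: proper_def distinct_card)

section \<open>Searching for a copy of a pattern\<close>

definition neighbours :: "(nat \<times> nat) list \<Rightarrow> nat \<Rightarrow> nat list" where
  "neighbours E u = map snd (filter (\<lambda>(x, y). x = u) E) @ map fst (filter (\<lambda>(x, y). y = u) E)"

text \<open>In the next two definitions, \<open>s\<close> is a partial injection of the vertices of the pattern into those
  of \<open>E\<close>, kept as an association list.\<close>

definition placements ::
    "(nat \<times> nat) list \<Rightarrow> (nat \<times> nat) list \<Rightarrow> nat \<Rightarrow> nat \<Rightarrow> (nat \<times> nat) list list" where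
  "placements E s a b = (let new = (\<lambda>u. u \<notin> set (map snd s)) in
     case map_of s a of
       None \<Rightarrow> (case map_of s b of
           None \<Rightarrow> concat (map (\<lambda>(u, v). [(a, u) # (b, v) # s, (a, v) # (b, u) # s])
             (filter (\<lambda>(u, v). new u \<and> new v) E))
         | Some v \<Rightarrow> map (\<lambda>u. (a, u) # s) (filter new (neighbours E v)))
     | Some u \<Rightarrow> (case map_of s b of
           None \<Rightarrow> map (\<lambda>v. (b, v) # s) (filter new (neighbours E u))
         | Some v \<Rightarrow> if v \<in> set (neighbours E u) then [s] else []))"

text \<open>The search is written with \<open>find\<close> and \<open>if\<close> because the simplifier evaluates these, unlike
  \<open>list_ex\<close> and \<open>\<or>\<close>, lazily.\<close>

fun embeddable :: "(nat \<times> nat) list \<Rightarrow> (nat \<times> nat) list \<Rightarrow> (nat \<times> nat) list \<Rightarrow> bool" where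
  "embeddable E s [] = True"
| "embeddable E s ((a, b) # S) = (find (\<lambda>t. embeddable E t S) (placements E s a b) \<noteq> None)"

lemma neighbours_iff: "v \<in> set (neighbours E u) \<longleftrightarrow> (u, v) \<in> set E \<or> (v, u) \<in> set E"
  by (force simp: neighbours_def)

text \<open>The cases follow which endpoints of the pattern edge \<open>(a, b)\<close> have been
  placed. New images are taken outside those in use, which keeps the assignment injective.\<close>

lemma placements_sound:
  assumes "t \<in> set (placements E s a b)" "distinct (map fst s)" "distinct (map snd s)"
    and "a \<noteq> b" "\<forall>(u, v)\<in>set E. u \<noteq> v"
  shows "distinct (map fst t) \<and> distinct (map snd t) \<and> set s \<subseteq> set t \<and>
    (\<exists>u v. (a, u) \<in> set t \<and> (b, v) \<in> set t \<and> {u, v} \<in> edge_set E)"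
proof -
  have E: "{u, v} \<in> edge_set E \<longleftrightarrow> (u, v) \<in> set E \<or> (v, u) \<in> set E" for u v
    by (force simp: edge_set_def doubleton_eq_iff)
  show ?thesis
  proof (cases "map_of s a")
    case None
    then have a: "a \<notin> fst ` set s"
      by (simp add: map_of_eq_None_iff)
    show ?thesis
    proof (cases "map_of s b")
      case b: None
      then have "b \<notin> fst ` set s"
        by (simp add: map_of_eq_None_iff)
      moreover obtain u v where "{u, v} \<in> edge_set E" "u \<noteq> v" "u \<notin> snd ` set s" "v \<notin> snd ` set s"
        "t = (a, u) # (b, v) # s"
      proof -
        obtain x y where "(x, y) \<in> set E" "x \<notin> snd ` set s" "y \<notin> snd ` set s"
          "t = (a, x) # (b, y) # s \<or> t = (a, y) # (b, x) # s"
          using assms(1) None b by (auto simp: placements_def Let_def)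
        moreover from this(1) have "x \<noteq> y"
          using assms(5) by blast
        ultimately show thesis
          using that[of x y] that[of y x] E by metis
      qed
      ultimately show ?thesis
        using assms(2-4) a by auto
    next
      case (Some v)
      then have "(b, v) \<in> set s"
        by (rule map_of_SomeD)
      moreover obtain u where "{u, v} \<in> edge_set E" "u \<notin> snd ` set s" "t = (a, u) # s"
        using assms(1) None Some by (auto simp: placements_def Let_def neighbours_iff E)
      ultimately show ?thesis
        using assms(2-4) a by auto
    qed
  next
    case u: (Some u)
    then have au: "(a, u) \<in> set s"
      by (rule map_of_SomeD)
    show ?thesis
    proof (cases "map_of s b")
      case None
      then have "b \<notin> fst ` set s"
        by (simp add: map_of_eq_None_iff)
      moreover obtain v where "{u, v} \<in> edge_set E" "v \<notin> snd ` set s" "t = (b, v) # s"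
        using assms(1) None u by (auto simp: placements_def Let_def neighbours_iff E)
      ultimately show ?thesis
        using assms(2-4) au by auto
    next
      case (Some v)
      then have "(b, v) \<in> set s"
        by (rule map_of_SomeD)
      moreover have "{u, v} \<in> edge_set E" "t = s"
        using assms(1) Some u
        by (auto simp: placements_def Let_def neighbours_iff E split: if_splits)
      ultimately show ?thesis
        using assms(2-4) au by auto
    qed
  qed
qed

text \<open>Assignments only grow along the search, so a pattern edge once placed stays
  placed.\<close>

lemma embeddable_extends:
  assumes "embeddable E s S" "distinct (map fst s)" "distinct (map snd s)"
    and "\<forall>(a, b)\<in>set S. a \<noteq> b" "\<forall>(u, v)\<in>set E. u \<noteq> v"
  shows "\<exists>t. distinct (map fst t) \<and> distinct (map snd t) \<and> set s \<subseteq> set t \<and>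
    (\<forall>(a, b)\<in>set S. \<exists>u v. (a, u) \<in> set t \<and> (b, v) \<in> set t \<and> {u, v} \<in> edge_set E)"
  using assms
proof (induction E s S rule: embeddable.induct)
  case (1 E s)
  then show ?case
    by auto
next
  case (2 E s a b S)
  obtain t where t: "t \<in> set (placements E s a b)" "embeddable E t S"
    using "2.prems"(1) by (auto simp: find_None_iff)
  have "a \<noteq> b"
    using "2.prems"(4) by auto
  note t' = placements_sound[OF t(1) "2.prems"(2,3) this "2.prems"(5)]
  then obtain u v where uv: "(a, u) \<in> set t" "(b, v) \<in> set t" "{u, v} \<in> edge_set E"
    by blast
  obtain r where r: "distinct (map fst r)" "distinct (map snd r)" "set t \<subseteq> set r"
    "\<forall>(a, b)\<in>set S. \<exists>u v. (a, u) \<in> set r \<and> (b, v) \<in> set r \<and> {u, v} \<in> edge_set E"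
    using "2.IH"[OF t] t' "2.prems"(4,5) by auto
  have "(a, u) \<in> set r \<and> (b, v) \<in> set r \<and> {u, v} \<in> edge_set E" "set s \<subseteq> set r"
    using uv r(3) t' by auto
  then show ?case
    using r(1,2,4) by (intro exI[of _ r]) auto
qed

text \<open>A successful search leaves an association list without repeated keys or values, that is,
  an injection. Every vertex of the pattern lies on an edge and so occurs among the keys.\<close>

lemma embeddable_sound:
  assumes "embeddable E [] S" "proper S" "proper E"
  shows "embeds (edge_set S) (edge_set E)"
proof -
  obtain t where t: "distinct (map fst t)" "distinct (map snd t)"
    "\<forall>(a, b)\<in>set S. \<exists>u v. (a, u) \<in> set t \<and> (b, v) \<in> set t \<and> {u, v} \<in> edge_set E"
    using embeddable_extends[OF assms(1)] assms(2,3) by (fastforce simp: proper_def)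
  define f where "f = the \<circ> map_of t"
  have f: "f a = u" if "(a, u) \<in> set t" for a u
    using that t(1) by (simp add: f_def)
  have edge: "\<exists>u v. (a, u) \<in> set t \<and> (b, v) \<in> set t \<and> {u, v} \<in> edge_set E" if "(a, b) \<in> set S" for a b
    using t(3) that by blast
  have "x \<in> fst ` set t" if x: "x \<in> \<Union>(edge_set S)" for x
  proof -
    obtain a b where "(a, b) \<in> set S" "x = a \<or> x = b"
      using x by (auto simp: edge_set_def)
    then show ?thesis
      using edge[of a b] by (auto intro: rev_image_eqI)
  qed
  moreover have "inj_on f (fst ` set t)"
  proof (rule inj_onI)
    fix x y assume "x \<in> fst ` set t" "y \<in> fst ` set t" and eq: "f x = f y"
    then obtain u v where uv: "(x, u) \<in> set t" "(y, v) \<in> set t"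
      by auto
    then have "u = v"
      using eq f by simp
    then show "x = y"
      using inj_onD[of snd "set t" "(x, u)" "(y, v)"] t(2) uv by (simp add: distinct_map)
  qed
  ultimately have "inj_on f (\<Union>(edge_set S))"
    by (meson inj_on_subset subsetI)
  moreover have "f ` e \<in> edge_set E" if e: "e \<in> edge_set S" for e
  proof -
    obtain a b where ab: "(a, b) \<in> set S" "e = {a, b}"
      using e by (auto simp: edge_set_def)
    then show ?thesis
      using edge[OF ab(1)] f by auto
  qed
  then have "(`) f ` edge_set S \<subseteq> edge_set E"
    by (rule image_subsetI)
  ultimately show ?thesis
    unfolding embeds_def by (intro exI conjI)
qed

section \<open>Jump graphs of edge lists\<close>

fun disjoint_pairs :: "nat \<times> nat \<Rightarrow> nat \<times> nat \<Rightarrow> bool" where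
  "disjoint_pairs (a, b) (c, d) \<longleftrightarrow> a \<noteq> c \<and> a \<noteq> d \<and> b \<noteq> c \<and> b \<noteq> d"

text \<open>\<open>n\<close> is the number of \<open>e\<close>. Numbers count from the end of the
  list, so prepending an edge leaves the others unchanged; later edges have smaller numbers, so each
  pair comes out increasing.\<close>

fun jump_row :: "nat \<times> nat \<Rightarrow> nat \<Rightarrow> (nat \<times> nat) list \<Rightarrow> (nat \<times> nat) list" where
  "jump_row e n [] = []"
| "jump_row e n (f # E) =
    (if disjoint_pairs e f then (length E, n) # jump_row e n E else jump_row e n E)"

text \<open>An edge of the list is numbered by the number of edges that follow it.\<close>

fun jump_list :: "(nat \<times> nat) list \<Rightarrow> (nat \<times> nat) list" where
  "jump_list [] = []"
| "jump_list (e # E) = jump_row e (length E) E @ jump_list E"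

lemma set_jump_row:
  "set (jump_row e n E) = {(j, n) | j. j < length E \<and> disjoint_pairs e (rev E ! j)}"
  by (induction E) (auto simp: nth_append less_Suc_eq)

lemma mem_jump_list:
  "(j, i) \<in> set (jump_list E) \<longleftrightarrow> j < i \<and> i < length E \<and> disjoint_pairs (rev E ! i) (rev E ! j)"
proof (induction E arbitrary: i j)
  case (Cons e E)
  consider "i < length E" | "i = length E" | "i > length E"
    by linarith
  then show ?case
    by cases (auto simp: Cons.IH set_jump_row nth_append)
qed simp

lemma distinct_jump_row: "distinct (jump_row e n E)"
  by (induction E) (auto simp: set_jump_row)

lemma proper_jump_list: "proper (jump_list E)"
proof -
  have "distinct (jump_list E)"
    by (induction E) (auto simp: set_jump_row mem_jump_list distinct_jump_row)
  then show ?thesis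
    by (auto simp: proper_def mem_jump_list)
qed

text \<open>The map \<open>f\<close> from numbers to edges is injective for a proper list and
  carries the numbered jump graph onto \<open>jmp (edge_set E)\<close>; the isomorphism is then
  reversed.\<close>

lemma isom_jmp_edge_set:
  assumes "proper E"
  shows "isom (jmp (edge_set E)) (edge_set (jump_list E))"
proof -
  define f where "f i = (case rev E ! i of (a, b) \<Rightarrow> {a, b})" for i
  have disj: "disjoint_pairs d e \<longleftrightarrow> (case d of (a, b) \<Rightarrow> {a, b}) \<inter> (case e of (a, b) \<Rightarrow> {a, b}) = {}" for d e
    by (cases d; cases e) auto
  have mem: "rev E ! i \<in> set E" if "i < length E" for i
    using that by (metis length_rev nth_mem set_rev)
  have inj: "inj_on f {..<length E}"
  proof (rule inj_onI)
    fix i j assume ij: "i \<in> {..<length E}" "j \<in> {..<length E}" "f i = f j"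
    then have "rev E ! i = rev E ! j"
      using inj_onD[OF inj_on_pair_set[OF assms]] mem by (auto simp: f_def)
    then show "i = j"
      using ij assms by (simp add: nth_eq_iff_index_eq proper_def)
  qed
  have sub: "\<Union>(edge_set (jump_list E)) \<subseteq> {..<length E}"
    by (auto simp: edge_set_def mem_jump_list)
  have "set E = (!) (rev E) ` {..<length E}"
    using nth_image[of "length E" "rev E"] by (simp add: lessThan_atLeast0)
  then have rng: "edge_set E = f ` {..<length E}"
    by (simp add: edge_set_def f_def image_image)
  have ne: "f i \<noteq> {}" for i
    by (simp add: f_def split: prod.splits)
  have dp: "disjoint_pairs (rev E ! i) (rev E ! j) \<longleftrightarrow> f i \<inter> f j = {}" for i j
    by (simp add: disj f_def)
  have "(`) f ` edge_set (jump_list E) = (\<lambda>(j, i). {f j, f i}) ` set (jump_list E)"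
    by (simp add: edge_set_def image_image split_def)
  also have "\<dots> = {x. \<exists>j i. (j < i \<and> i < length E \<and> f i \<inter> f j = {}) \<and> x = {f j, f i}}"
    by (simp add: image_def Bex_def split_paired_Ex mem_jump_list dp)
  also have "\<dots> = jmp (edge_set E)"
  proof (intro equalityI subsetI)
    fix x assume "x \<in> {x. \<exists>j i. (j < i \<and> i < length E \<and> f i \<inter> f j = {}) \<and> x = {f j, f i}}"
    then obtain i j where "x = {f j, f i}" "j < length E" "i < length E" "f j \<inter> f i = {}"
      by (auto simp: Int_commute)
    then show "x \<in> jmp (edge_set E)"
      by (simp add: rng jmpI)
  next
    fix x assume "x \<in> jmp (edge_set E)"
    then obtain i j where ij: "x = {f j, f i}" "j < length E" "i < length E" "f j \<inter> f i = {}"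
      unfolding jmp_def rng by auto
    \<comment> \<open>An edge is nonempty and so never disjoint from itself.\<close>
    then have "i \<noteq> j"
      using ne by auto
    then consider "j < i" | "i < j"
      by linarith
    then show "x \<in> {x. \<exists>j i. (j < i \<and> i < length E \<and> f i \<inter> f j = {}) \<and> x = {f j, f i}}"
    proof cases
      case 1
      then show ?thesis
        using ij by (intro CollectI exI[of _ j] exI[of _ i]) (simp add: Int_commute)
    next
      case 2
      then show ?thesis
        using ij by (intro CollectI exI[of _ i] exI[of _ j]) (simp add: insert_commute)
    qed
  qed
  finally have "isom (edge_set (jump_list E)) (jmp (edge_set E))"
    unfolding isom_def using inj_on_subset[OF inj sub] by blast
  then show ?thesis
    by (rule isom_sym)
qed

section \<open>Extending an edge list\<close>

lemma edge_set_Cons: "edge_set (d # E) = insert (case d of (a, b) \<Rightarrow> {a, b}) (edge_set E)"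
  by (simp add: edge_set_def)

fun vertex_bound :: "(nat \<times> nat) list \<Rightarrow> nat" where
  "vertex_bound [] = 0"
| "vertex_bound ((a, b) # E) = max (Suc b) (vertex_bound E)"

definition pairs_below :: "nat \<Rightarrow> (nat \<times> nat) list" where
  "pairs_below n = concat (map (\<lambda>b. map (\<lambda>a. (a, b)) [0..<b]) [0..<n])"

text \<open>Up to renaming, a new edge has zero, one or two new vertices. As \<open>n\<close>
  exceeds all labels in use, the pairs below \<open>Suc n\<close> provide the first two kinds and
  \<open>(n, Suc n)\<close> the third.\<close>

definition extensions :: "(nat \<times> nat) list \<Rightarrow> (nat \<times> nat) list list" where
  "extensions E = (let n = vertex_bound E in
     ((n, Suc n) # E) # map (\<lambda>d. d # E) (filter (\<lambda>d. d \<notin> set E) (pairs_below (Suc n))))"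

lemma set_pairs_below: "set (pairs_below n) = {(a, b). a < b \<and> b < n}"
  by (auto simp: pairs_below_def)

lemma vertex_bound_less:
  assumes "proper E" "x \<in> \<Union>(edge_set E)"
  shows "x < vertex_bound E"
  using assms
proof (induction E)
  case (Cons d E)
  obtain a b where d: "d = (a, b)"
    by fastforce
  have "proper E" "a < b"
    using Cons.prems(1) by (auto simp: proper_def d)
  moreover have "x = a \<or> x = b \<or> x \<in> \<Union>(edge_set E)"
    using Cons.prems(2) by (auto simp: d)
  ultimately show ?case
    using Cons.IH by (auto simp: d less_max_iff_disj)
qed simp

lemma Cons_in_extensions:
  assumes "proper E" "a < b" "b \<le> vertex_bound E" "{a, b} \<notin> edge_set E"
  shows "(a, b) # E \<in> set (extensions E) \<and> proper ((a, b) # E)"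
proof -
  have "(a, b) \<notin> set E"
    using assms(4) by (force simp: edge_set_def)
  then show ?thesis
    using assms by (auto simp: extensions_def Let_def set_pairs_below proper_def)
qed

text \<open>The cases count the endpoints of \<open>e\<close> that are already images. The others
  become the images of the fresh labels \<open>n\<close> and \<open>Suc n\<close>, and
  \<open>f\<close> is kept on the old vertices.\<close>

lemma embedding_extends:
  assumes "proper E" "inj_on f (\<Union>(edge_set E))" "card e = 2" "e \<notin> (`) f ` edge_set E"
  obtains d g where "d # E \<in> set (extensions E)" "proper (d # E)"
    "inj_on g (\<Union>(edge_set (d # E)))" "\<forall>x\<in>\<Union>(edge_set E). g x = f x"
    "g ` (case d of (a, b) \<Rightarrow> {a, b}) = e"
proof -
  define V where "V = \<Union>(edge_set E)"
  define n where "n = vertex_bound E"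
  have V: "x < n" if "x \<in> V" for x
    using vertex_bound_less[OF assms(1)] that by (simp add: V_def n_def)
  have fV: "inj_on f V"
    using assms(2) by (simp add: V_def)
  have EV: "{a, b} \<notin> edge_set E" if "a \<notin> V \<or> b \<notin> V" for a b
    using that by (auto simp: V_def)
  have U: "\<Union>(edge_set ((a, b) # E)) = insert a (insert b V)" for a b
    by (auto simp: V_def)
  obtain u v where uv: "e = {u, v}" "u \<noteq> v"
    using assms(3) by (auto simp: card_2_iff)
  \<comment> \<open>The endpoints are named so that, if just one is already an image, it is
    \<open>x\<close>.\<close>
  obtain x y where xy: "e = {x, y}" "x \<noteq> y" and c: "x \<in> f ` V \<or> y \<notin> f ` V"
  proof (cases "u \<in> f ` V")
    case True
    then show thesis
      using that[of u v] uv by simp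
  next
    case False
    then show thesis
      using that[of v u] uv by (simp add: insert_commute)
  qed
  consider "x \<in> f ` V" "y \<in> f ` V" | "x \<in> f ` V" "y \<notin> f ` V" | "x \<notin> f ` V" "y \<notin> f ` V"
    using c by blast
  then show thesis
  proof cases
    case 1
    then obtain a b where ab: "a \<in> V" "b \<in> V" "x = f a" "y = f b"
      by auto
    have "f ` {a, b} = e" "f ` {b, a} = e"
      using ab xy by auto
    then have new: "{a, b} \<notin> edge_set E" "{b, a} \<notin> edge_set E"
      using assms(4) by (metis imageI)+
    have less: "a < n" "b < n" "a \<noteq> b"
      using ab V xy by auto
    have U1: "insert a (insert b V) = V" "insert b (insert a V) = V"
      using ab by auto
    show thesis
    proof (cases "a < b")
      case True
      show thesis
      proof (rule that[of "(a, b)" f])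
        show "(a, b) # E \<in> set (extensions E)" "proper ((a, b) # E)"
          using Cons_in_extensions[OF assms(1) True _ new(1)] less by (auto simp: n_def)
        show "inj_on f (\<Union>(edge_set ((a, b) # E)))"
          using fV unfolding U U1 .
      qed (use ab xy in auto)
    next
      case False
      then have ba: "b < a"
        using less by simp
      show thesis
      proof (rule that[of "(b, a)" f])
        show "(b, a) # E \<in> set (extensions E)" "proper ((b, a) # E)"
          using Cons_in_extensions[OF assms(1) ba _ new(2)] less by (auto simp: n_def)
        show "inj_on f (\<Union>(edge_set ((b, a) # E)))"
          using fV unfolding U U1 .
      qed (use ab xy in auto)
    qed
  next
    case 2
    then obtain a where a: "a \<in> V" "x = f a"
      by auto
    define g where "g = f(n := y)"
    have g: "g z = f z" if "z \<in> V" for z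
      using V[OF that] by (simp add: g_def)
    have "n \<notin> V" "g n = y"
      using V by (auto simp: g_def)
    then have "inj_on g (insert n V)"
      using fV 2(2) g by (simp add: inj_on_def) (metis imageI)
    moreover have "insert a (insert n V) = insert n V"
      using a by auto
    ultimately have inj: "inj_on g (\<Union>(edge_set ((a, n) # E)))"
      unfolding U by simp
    show thesis
    proof (rule that[of "(a, n)" g])
      show "(a, n) # E \<in> set (extensions E)" "proper ((a, n) # E)"
        using Cons_in_extensions[OF assms(1) V[OF a(1)] _ EV] \<open>n \<notin> V\<close> by (auto simp: n_def)
    qed (use inj g a xy \<open>g n = y\<close> in \<open>auto simp: V_def\<close>)
  next
    case 3
    define g where "g = f(n := x, Suc n := y)"
    have g: "g z = f z" if "z \<in> V" for z
      using V[OF that] by (simp add: g_def)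
    have n: "n \<notin> V" "Suc n \<notin> V" "g n = x" "g (Suc n) = y"
      using V[of n] V[of "Suc n"] by (auto simp: g_def)
    then have inj: "inj_on g (\<Union>(edge_set ((n, Suc n) # E)))"
      unfolding U using fV 3 g xy(2) by (simp add: inj_on_def) (metis imageI)
    show thesis
    proof (rule that[of "(n, Suc n)" g])
      show "(n, Suc n) # E \<in> set (extensions E)" "proper ((n, Suc n) # E)"
        using assms(1) EV[of n "Suc n"] n
        by (auto simp: extensions_def n_def Let_def proper_def edge_set_def)
    qed (use inj g xy n in \<open>auto simp: V_def\<close>)
  qed
qed

text \<open>An embedding that is not an isomorphism misses an edge of \<open>A\<close>, and that
  edge can be adjoined.\<close>

lemma embeds_extends:
  assumes "proper E" "two_uniform A" "embeds (edge_set E) A" "\<not> isom (edge_set E) A"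
  shows "\<exists>F\<in>set (extensions E). proper F \<and> length F = Suc (length E) \<and> embeds (edge_set F) A"
proof -
  obtain f where f: "inj_on f (\<Union>(edge_set E))" "(`) f ` edge_set E \<subseteq> A"
    using assms(3) by (auto simp: embeds_def)
  have "(`) f ` edge_set E \<noteq> A"
    using assms(4) f(1) by (auto simp: isom_def)
  then obtain e where e: "e \<in> A" "e \<notin> (`) f ` edge_set E"
    using psubsetI[OF f(2)] by (meson psubset_imp_ex_mem DiffD1 DiffD2)
  then have "card e = 2"
    using assms(2) by (simp add: two_uniform_def)
  obtain d g where d: "d # E \<in> set (extensions E)" "proper (d # E)"
    "inj_on g (\<Union>(edge_set (d # E)))" "\<forall>x\<in>\<Union>(edge_set E). g x = f x"
    "g ` (case d of (a, b) \<Rightarrow> {a, b}) = e"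
    by (rule embedding_extends[OF assms(1) f(1) \<open>card e = 2\<close> e(2)])
  have "g ` c = f ` c" if "c \<in> edge_set E" for c
    using d(4) that by (auto intro: image_cong)
  then have "(`) g ` edge_set E = (`) f ` edge_set E"
    by (rule image_cong[OF refl])
  then have "(`) g ` edge_set (d # E) \<subseteq> A"
    using f(2) d(5) e(1) by (simp add: edge_set_Cons)
  then have "embeds (edge_set (d # E)) A"
    using d(3) unfolding embeds_def by (intro exI conjI)
  then show ?thesis
    using d(1,2) by (intro bexI[of _ "d # E"]) simp_all
qed

text \<open>The head of each list is the edge added last, so the two added edges are disjoint from
  each other. Done twice from the empty list, this yields the four edges behind an edge of the
  second jump graph.\<close>

definition matched_extensions :: "(nat \<times> nat) list \<Rightarrow> (nat \<times> nat) list list" where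
  "matched_extensions E = concat (map (\<lambda>F. filter (\<lambda>F'. disjoint_pairs (hd F) (hd F')) (extensions F))
     (extensions E))"

lemma embedding_extends_matched:
  assumes "proper E" "inj_on f (\<Union>(edge_set E))"
    and "card d = 2" "card e = 2" "d \<inter> e = {}"
    and "d \<notin> (`) f ` edge_set E" "e \<notin> (`) f ` edge_set E"
  shows "\<exists>F\<in>set (matched_extensions E). \<exists>g. proper F \<and> length F = length E + 2 \<and>
    inj_on g (\<Union>(edge_set F)) \<and> (`) g ` edge_set F = insert d (insert e ((`) f ` edge_set E))"
proof -
  obtain c g where c: "c # E \<in> set (extensions E)" "proper (c # E)"
    "inj_on g (\<Union>(edge_set (c # E)))" "\<forall>x\<in>\<Union>(edge_set E). g x = f x"
    "g ` (case c of (a, b) \<Rightarrow> {a, b}) = d"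
    by (rule embedding_extends[OF assms(1,2,3,6)])
  have "g ` x = f ` x" if "x \<in> edge_set E" for x
    using c(4) that by (auto intro: image_cong)
  then have "(`) g ` edge_set E = (`) f ` edge_set E"
    by (rule image_cong[OF refl])
  then have gE: "(`) g ` edge_set (c # E) = insert d ((`) f ` edge_set E)"
    using c(5) by (simp add: edge_set_Cons)
  have "e \<noteq> d"
    using assms(3,5) by auto
  then have new: "e \<notin> (`) g ` edge_set (c # E)"
    using gE assms(7) by simp
  obtain c' h where c': "c' # c # E \<in> set (extensions (c # E))" "proper (c' # c # E)"
    "inj_on h (\<Union>(edge_set (c' # c # E)))" "\<forall>x\<in>\<Union>(edge_set (c # E)). h x = g x"
    "h ` (case c' of (a, b) \<Rightarrow> {a, b}) = e"
    by (rule embedding_extends[OF c(2,3) assms(4) new])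
  have hg: "h ` x = g ` x" if "x \<in> edge_set (c # E)" for x
    using c'(4) that by (auto intro: image_cong)
  then have "(`) h ` edge_set (c # E) = (`) g ` edge_set (c # E)"
    by (rule image_cong[OF refl])
  then have "(`) h ` edge_set (c' # c # E) = insert d (insert e ((`) f ` edge_set E))"
    unfolding edge_set_Cons[of c'] image_insert gE c'(5) by (simp add: insert_commute)
  moreover have "h ` (case c of (a, b) \<Rightarrow> {a, b}) = d"
    using hg c(5) by (simp add: edge_set_Cons)
  then have "disjoint_pairs c c'"
    using c'(5) assms(5) by (cases c; cases c') auto
  then have "c' # c # E \<in> set (matched_extensions E)"
    using c(1) c'(1) by (auto simp: matched_extensions_def)
  ultimately show ?thesis
    using c'(2,3) by (intro bexI[of _ "c' # c # E"] exI[of _ h]) simp_all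
qed

subsection \<open>The five-cycle and the net\<close>

definition five_cycle :: "(nat \<times> nat) list" where
  "five_cycle = [(0, 1), (1, 2), (2, 3), (3, 4), (0, 4)]"

definition net :: "(nat \<times> nat) list" where
  "net = [(0, 1), (1, 2), (0, 2), (0, 3), (1, 4), (2, 5)]"

lemma proper_five_cycle: "proper five_cycle"
  by (simp add: proper_def five_cycle_def)

lemma proper_net: "proper net"
  by (simp add: proper_def net_def)

text \<open>An embedding between graphs with equally many edges is an isomorphism, which reduces the
  fixed-point property to a search and a count.\<close>

lemma isom_jmp_self:
  assumes "proper E" "embeddable (jump_list E) [] E" "length (jump_list E) = length E"
  shows "isom (jmp (edge_set E)) (edge_set E)"
proof -
  have "embeds (edge_set E) (edge_set (jump_list E))"
    using assms(1,2) by (intro embeddable_sound proper_jump_list)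
  then have "isom (edge_set E) (edge_set (jump_list E))"
    using assms by (intro embeds_card_isom) (simp_all add: card_edge_set proper_jump_list)
  then show ?thesis
    using isom_jmp_edge_set[OF assms(1)] isom_sym isom_trans by blast
qed

lemma isom_jmp_five_cycle: "isom (jmp (edge_set five_cycle)) (edge_set five_cycle)"
  by (rule isom_jmp_self[OF proper_five_cycle]) code_simp+

lemma isom_jmp_net: "isom (jmp (edge_set net)) (edge_set net)"
  by (rule isom_jmp_self[OF proper_net]) code_simp+

lemma isom_five_cycleE:
  assumes "isom (edge_set five_cycle) C"
  obtains a b c d e where "distinct [a, b, c, d, e]" "C = cycle5 a b c d e"
proof -
  obtain f where f: "inj_on f (\<Union>(edge_set five_cycle))" "(`) f ` edge_set five_cycle = C"
    using assms by (auto simp: isom_def)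
  have "\<Union>(edge_set five_cycle) = {0, 1, 2, 3, 4}"
    by (auto simp: five_cycle_def)
  then have "distinct [f 0, f 1, f 2, f 3, f 4]"
    using f(1) by (auto simp: inj_on_def)
  moreover have "C = cycle5 (f 0) (f 1) (f 2) (f 3) (f 4)"
    unfolding f(2)[symmetric] by (simp add: five_cycle_def cycle5_def)
  ultimately show thesis
    by (rule that)
qed

lemma isom_netE:
  assumes "isom (edge_set net) C"
  obtains a b c x y z where "distinct [a, b, c, x, y, z]" "C = net6 a b c x y z"
proof -
  obtain f where f: "inj_on f (\<Union>(edge_set net))" "(`) f ` edge_set net = C"
    using assms by (auto simp: isom_def)
  have "\<Union>(edge_set net) = {0, 1, 2, 3, 4, 5}"
    by (auto simp: net_def)
  then have "distinct [f 0, f 1, f 2, f 3, f 4, f 5]"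
    using f(1) by (auto simp: inj_on_def)
  moreover have "C = net6 (f 0) (f 1) (f 2) (f 3) (f 4) (f 5)"
    unfolding f(2)[symmetric] by (simp add: net_def net6_def)
  ultimately show thesis
    by (rule that)
qed

lemma card_jmp_of_isom:
  assumes "isom (jmp C) C" "isom C D"
  shows "card D \<le> card (jmp D)"
  using isom_card[OF assms(1)] isom_card[OF assms(2)] isom_card[OF isom_jmp[OF assms(2)]] by simp

lemma embedsE:
  assumes "embeds A B"
  obtains C where "C \<subseteq> B" "isom A C"
  using assms unfolding embeds_def isom_def by blast

text \<open>Every edge outside the cycle has a disjoint partner in it; one that leaves the vertex
  set of the cycle has at least two, which makes the inequality strict.\<close>

lemma card_le_of_five_cycle:
  assumes "two_uniform A" "C \<subseteq> A" "isom (edge_set five_cycle) C"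
  shows "card A \<le> card (jmp A)"
    and "f \<in> A \<Longrightarrow> \<not> f \<subseteq> \<Union>C \<Longrightarrow> card A < card (jmp A)"
proof -
  obtain a b c d e where C: "distinct [a, b, c, d, e]" "C = cycle5 a b c d e"
    using assms(3) by (rule isom_five_cycleE)
  have card: "card C \<le> card (jmp C)"
    using isom_jmp_five_cycle assms(3) by (rule card_jmp_of_isom)
  have 2: "card g = 2" if "g \<in> A" for g
    using assms(1) that by (simp add: two_uniform_def)
  have avoid: "\<forall>g\<in>A - C. \<exists>h\<in>C. g \<inter> h = {}"
    using pair_avoiding_cycle5(1)[OF C(1) 2] unfolding C(2) by blast
  show "card A \<le> card (jmp A)"
    by (rule card_le_card_jmp(1)[OF assms(1,2) card avoid])
  assume f: "f \<in> A" "\<not> f \<subseteq> \<Union>C"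
  then have fC: "f \<in> A - C"
    by blast
  have "\<Union>C = {a, b, c, d, e}"
    unfolding C(2) cycle5_def by auto
  then obtain g h where "g \<in> C" "h \<in> C" "g \<noteq> h" "f \<inter> g = {}" "f \<inter> h = {}"
    using pair_avoiding_cycle5(2)[OF C(1) 2[OF f(1)]] fC f(2) unfolding C(2) by blast
  then show "card A < card (jmp A)"
    by (rule card_le_card_jmp(2)[OF assms(1,2) card avoid fC])
qed

text \<open>A chord of the cycle is disjoint from only one of its edges, but in the jump graph that pair is
  an edge leaving the new cycle.\<close>

lemma card_less_of_five_cycle:
  assumes "two_uniform A" "C \<subseteq> A" "C \<noteq> A" "isom (edge_set five_cycle) C"
  shows "card A < card (jmp A) \<or> card (jmp A) < card (jmp (jmp A))"
proof -
  obtain f where f: "f \<in> A" "f \<notin> C"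
    using assms(2,3) by blast
  show ?thesis
  proof (cases "f \<subseteq> \<Union>C")
    case True
    obtain a b c d e where C: "distinct [a, b, c, d, e]" "C = cycle5 a b c d e"
      using assms(4) by (rule isom_five_cycleE)
    have "card f = 2"
      using assms(1) f by (simp add: two_uniform_def)
    then obtain g where g: "g \<in> C" "f \<inter> g = {}"
      using pair_avoiding_cycle5(1)[OF C(1)] f(2) unfolding C(2) by blast
    have "{f, g} \<in> jmp A"
      using f g assms(2) by (intro jmpI) auto
    moreover have "\<not> {f, g} \<subseteq> \<Union>(jmp C)"
      using f(2) Union_jmp_subset[of C] by blast
    moreover have "isom (edge_set five_cycle) (jmp C)"
      using isom_jmp_five_cycle isom_jmp[OF assms(4)] isom_sym isom_trans by blast
    ultimately show ?thesis
      using card_le_of_five_cycle(2)[OF two_uniform_jmp[OF assms(1)] jmp_mono[OF assms(2)]] by blast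
  next
    case False
    then show ?thesis
      using card_le_of_five_cycle(2)[OF assms(1,2,4) f(1)] by blast
  qed
qed

text \<open>Every edge outside the net has two disjoint partners in it, so a single jump already
  gives strict growth, unlike for a chord of the five-cycle.\<close>

lemma card_le_of_net:
  assumes "two_uniform A" "C \<subseteq> A" "isom (edge_set net) C"
  shows "card A \<le> card (jmp A)" and "C \<noteq> A \<Longrightarrow> card A < card (jmp A)"
proof -
  obtain a b c x y z where C: "distinct [a, b, c, x, y, z]" "C = net6 a b c x y z"
    using assms(3) by (rule isom_netE)
  have card: "card C \<le> card (jmp C)"
    using isom_jmp_net assms(3) by (rule card_jmp_of_isom)
  have two: "\<exists>g\<in>C. \<exists>h\<in>C. g \<noteq> h \<and> f \<inter> g = {} \<and> f \<inter> h = {}" if "f \<in> A - C" for f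
  proof -
    have "card f = 2" "f \<notin> net6 a b c x y z"
      using that assms(1) C(2) by (auto simp: two_uniform_def)
    then show ?thesis
      unfolding C(2) by (rule pair_avoiding_net6[OF C(1)])
  qed
  then have avoid: "\<forall>f\<in>A - C. \<exists>g\<in>C. f \<inter> g = {}"
    by meson
  show "card A \<le> card (jmp A)"
    by (rule card_le_card_jmp(1)[OF assms(1,2) card avoid])
  assume "C \<noteq> A"
  then obtain f where f: "f \<in> A - C"
    using assms(2) by blast
  then obtain g h where "g \<in> C" "h \<in> C" "g \<noteq> h" "f \<inter> g = {}" "f \<inter> h = {}"
    using two by meson
  then show "card A < card (jmp A)"
    by (rule card_le_card_jmp(2)[OF assms(1,2) card avoid f])
qed

section \<open>Periodic sequences of jump graphs\<close>

locale periodic_jump =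
  fixes A :: "nat \<Rightarrow> 'b set set" and p :: nat
  assumes uniform: "two_uniform (A k)"
    and step: "isom (jmp (A k)) (A (Suc k))"
    and period: "isom (A p) (A 0)"
    and p_pos: "p > 0"
    and nonempty: "A 0 \<noteq> {}"
begin

lemma isom_add_period: "isom (A (k + p)) (A k)"
proof (induction k)
  case (Suc k)
  have "isom (A (Suc k + p)) (jmp (A (k + p)))"
    using isom_sym[OF step] by simp
  then show ?case
    by (rule isom_trans[OF _ isom_trans[OF isom_jmp[OF Suc.IH] step]])
qed (use period in simp)

lemma isom_mult_period: "isom (A (n * p)) (A 0)"
proof (induction n)
  case (Suc n)
  have "isom (A (Suc n * p)) (A (n * p))"
    using isom_add_period[of "n * p"] by (simp add: add.commute)
  then show ?case
    using Suc.IH by (rule isom_trans)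
qed (simp add: isom_refl)

text \<open>A fixed graph persists at every later index, in particular at the multiple
  \<open>k * p\<close> of the period, where the sequence is back at \<open>A 0\<close>.\<close>

lemma isom_fixed:
  assumes "isom (jmp C) C" "isom C (A k)"
  shows "isom C (A 0)"
proof -
  have "isom C (A (k + i))" for i
  proof (induction i)
    case (Suc i)
    have "isom C (jmp (A (k + i)))"
      using isom_trans[OF isom_sym[OF assms(1)] isom_jmp[OF Suc.IH]] .
    then show ?case
      using isom_trans[OF _ step[of "k + i"]] by simp
  qed (use assms(2) in simp)
  moreover have "k + (k * p - k) = k * p"
    using p_pos by simp
  ultimately have "isom C (A (k * p))"
    by metis
  then show ?thesis
    by (rule isom_trans[OF _ isom_mult_period])
qed

text \<open>The empty graph is itself fixed, so its occurrence anywhere would make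
  \<open>A 0\<close> empty.\<close>

lemma not_empty: "A k \<noteq> {}"
proof
  assume "A k = {}"
  then have "isom ({} :: 'b set set) (A k)"
    using isom_refl by metis
  moreover have "isom (jmp ({} :: 'b set set)) ({} :: 'b set set)"
    by (simp add: jmp_def isom_def)
  ultimately have "isom ({} :: 'b set set) (A 0)"
    using isom_fixed by metis
  then show False
    using nonempty by (simp add: isom_def)
qed

lemma embeds_Suc: "embeds C (A k) \<Longrightarrow> embeds (jmp C) (A (Suc k))"
  by (rule embeds_trans[OF embeds_jmp isom_imp_embeds[OF step]])

lemma embeds_fixed:
  assumes "isom (jmp C) C" "embeds C (A k)" "k \<le> i"
  shows "embeds C (A i)"
  using assms(3)
proof (induction i rule: dec_induct)
  case (step i)
  show ?case
    using embeds_trans[OF isom_imp_embeds[OF isom_sym[OF assms(1)]] embeds_Suc[OF step.IH]] .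
qed (use assms(2) in simp)

lemma card_Suc: "card (A (Suc k)) = card (jmp (A k))"
  using isom_card[OF step] by simp

text \<open>From \<open>Suc k\<close> on the sizes cannot drop, yet at \<open>k + p\<close> the size
  is again that at \<open>k\<close>.\<close>

lemma card_constant:
  assumes "\<And>i. k \<le> i \<Longrightarrow> card (A i) \<le> card (A (Suc i))"
  shows "card (A (Suc k)) = card (A k)"
proof -
  have "card (A (Suc k)) \<le> card (A (Suc k + i))" for i
  proof (induction i)
    case (Suc i)
    then show ?case
      using assms[of "Suc k + i"] by simp
  qed simp
  then have "card (A (Suc k)) \<le> card (A (Suc k + (p - 1)))" .
  also have "\<dots> = card (A k)"
    using isom_card[OF isom_add_period[of k]] p_pos by simp
  finally show ?thesis
    using assms[of k] by simp
qed

text \<open>The sizes are constant from \<open>k\<close> on, whereas a copy of the five-cycle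
  missing an edge of \<open>A k\<close> would force growth within two jumps. So the copy is all of
  \<open>A k\<close>.\<close>

lemma isom_five_cycle:
  assumes "embeds (edge_set five_cycle) (A k)"
  shows "isom (edge_set five_cycle) (A 0)"
proof -
  have mono: "card (A i) \<le> card (A (Suc i))" if "k \<le> i" for i
    using embeds_fixed[OF isom_jmp_five_cycle assms that] card_le_of_five_cycle(1)[OF uniform]
    by (metis card_Suc embedsE)
  have "card (A (Suc k)) = card (A k)" "card (A (Suc (Suc k))) = card (A (Suc k))"
    using mono by (auto intro!: card_constant)
  moreover have "card (A (Suc (Suc k))) = card (jmp (jmp (A k)))"
    using isom_card[OF isom_jmp[OF step]] card_Suc by simp
  ultimately have eq: "card (A k) = card (jmp (A k))" "card (jmp (A k)) = card (jmp (jmp (A k)))"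
    using card_Suc by simp_all
  obtain C where C: "C \<subseteq> A k" "isom (edge_set five_cycle) C"
    using assms by (rule embedsE)
  then have "C = A k"
    using card_less_of_five_cycle[OF uniform C(1) _ C(2)] eq by fastforce
  then show ?thesis
    using isom_fixed[OF isom_jmp_five_cycle] C(2) by simp
qed

lemma isom_net:
  assumes "embeds (edge_set net) (A k)"
  shows "isom (edge_set net) (A 0)"
proof -
  have mono: "card (A i) \<le> card (A (Suc i))" if "k \<le> i" for i
    using embeds_fixed[OF isom_jmp_net assms that] card_le_of_net(1)[OF uniform]
    by (metis card_Suc embedsE)
  then have eq: "card (A k) = card (jmp (A k))"
    using card_constant[OF mono] card_Suc by simp
  obtain C where C: "C \<subseteq> A k" "isom (edge_set net) C"
    using assms by (rule embedsE)
  then have "C = A k"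
    using card_le_of_net(2)[OF uniform C] eq by fastforce
  then show ?thesis
    using isom_fixed[OF isom_jmp_net] C(2) by simp
qed

end

subsection \<open>The search\<close>

text \<open>Up to isomorphism, all graphs met in the search that do not lead to \<open>C\<^sub>5\<close> or \<open>N\<close>.\<close>

definition mortal_graphs_4 :: "(nat \<times> nat) list list" where
  "mortal_graphs_4 =
   [[(0, 1), (1, 2), (2, 3), (0, 3)],
    [(0, 1), (1, 2), (2, 3), (3, 4)],
    [(0, 1), (1, 2), (2, 3), (4, 5)],
    [(0, 1), (1, 2), (3, 4), (4, 5)],
    [(0, 1), (1, 2), (3, 4), (5, 6)],
    [(0, 1), (2, 3), (4, 5), (6, 7)]]"

text \<open>The diamond; the four-cycle with a pendant or a disjoint edge; the triangle with a tail
  of length two; the bull; the spiders with legs 1, 1, 3 and 1, 2, 2; the paw, and the spider with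
  legs 1, 1, 2, each with a disjoint edge; the double star with two leaves at each centre.\<close>

definition mortal_graphs_5 :: "(nat \<times> nat) list list" where
  "mortal_graphs_5 =
   [[(0, 2), (0, 1), (1, 2), (2, 3), (0, 3)],
    [(0, 4), (0, 1), (1, 2), (2, 3), (0, 3)],
    [(0, 1), (1, 2), (2, 3), (0, 3), (4, 5)],
    [(0, 2), (0, 1), (1, 2), (2, 3), (3, 4)],
    [(1, 3), (0, 1), (1, 2), (2, 3), (3, 4)],
    [(1, 5), (0, 1), (1, 2), (2, 3), (3, 4)],
    [(2, 5), (0, 1), (1, 2), (2, 3), (3, 4)],
    [(0, 2), (0, 1), (1, 2), (2, 3), (4, 5)],
    [(1, 6), (0, 1), (1, 2), (2, 3), (4, 5)],
    [(1, 4), (0, 1), (1, 2), (3, 4), (4, 5)]]"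

text \<open>The complete graph on four vertices; the diamond with a pendant edge at a vertex of
  degree three or two; two triangles sharing a vertex; the triangle with a pendant edge and a tail
  of length two at one vertex; the bull with a second pendant edge at a vertex that has one.\<close>

definition mortal_graphs_6 :: "(nat \<times> nat) list list" where
  "mortal_graphs_6 =
   [[(1, 3), (0, 2), (0, 1), (1, 2), (2, 3), (0, 3)],
    [(0, 4), (0, 2), (0, 1), (1, 2), (2, 3), (0, 3)],
    [(1, 4), (0, 2), (0, 1), (1, 2), (2, 3), (0, 3)],
    [(2, 4), (0, 2), (0, 1), (1, 2), (2, 3), (3, 4)],
    [(2, 5), (0, 2), (0, 1), (1, 2), (2, 3), (3, 4)],
    [(1, 5), (1, 3), (0, 1), (1, 2), (2, 3), (3, 4)]]"

definition mortal_graphs :: "(nat \<times> nat) list list" where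
  "mortal_graphs = mortal_graphs_4 @ mortal_graphs_5 @ mortal_graphs_6"

fun reaches_five_cycle :: "nat \<Rightarrow> (nat \<times> nat) list \<Rightarrow> bool" where
  "reaches_five_cycle 0 E = embeddable E [] five_cycle"
| "reaches_five_cycle (Suc k) E =
    (if embeddable E [] five_cycle then True else reaches_five_cycle k (jump_list E))"

text \<open>Equal length turns the embedding of a listed graph into an isomorphism. The deeper
  search for a five-cycle stands last and is run only when the other tests fail.\<close>

definition covered :: "(nat \<times> nat) list \<Rightarrow> bool" where
  "covered E =
    (if reaches_five_cycle 1 E then True
     else if find (\<lambda>S. if length S = length E then embeddable E [] S else False) mortal_graphs \<noteq> None
       then True
     else if embeddable E [] net then True
     else reaches_five_cycle 4 E)"

lemma proper_mortal_graphs: "\<forall>S\<in>set mortal_graphs. proper S"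
  by (simp add: mortal_graphs_def mortal_graphs_4_def mortal_graphs_5_def mortal_graphs_6_def proper_def)

lemma length_mortal_graphs: "\<forall>S\<in>set mortal_graphs. length S < 7"
  by (simp add: mortal_graphs_def mortal_graphs_4_def mortal_graphs_5_def mortal_graphs_6_def)

lemma mortal_graphs_die: "\<forall>S\<in>set mortal_graphs. (jump_list ^^ 6) S = []"
  unfolding list_all_iff[symmetric] by code_simp

lemma covered_matched_extensions:
  "\<forall>E\<in>set (matched_extensions []). \<forall>F\<in>set (matched_extensions E). length F = 4 \<and> covered F"
  unfolding list_all_iff[symmetric] by code_simp

lemma covered_extensions_4: "\<forall>S\<in>set mortal_graphs_4. \<forall>F\<in>set (extensions S). covered F"
  unfolding list_all_iff[symmetric] by code_simp

lemma covered_extensions_5: "\<forall>S\<in>set mortal_graphs_5. \<forall>F\<in>set (extensions S). covered F"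
  unfolding list_all_iff[symmetric] by code_simp

text \<open>No listed graph has seven edges, so here every extension leads to a five-cycle or
  contains a net; this ends the search.\<close>

lemma covered_extensions_6: "\<forall>S\<in>set mortal_graphs_6. \<forall>F\<in>set (extensions S). covered F"
  unfolding list_all_iff[symmetric] by code_simp

lemma covered_extensions: "\<forall>S\<in>set mortal_graphs. \<forall>F\<in>set (extensions S). covered F"
  using covered_extensions_4 covered_extensions_5 covered_extensions_6
  by (auto simp: mortal_graphs_def)

section \<open>The search applied to a periodic sequence\<close>

context periodic_jump
begin

lemma embeds_jump_list:
  assumes "proper E" "embeds (edge_set E) (A k)"
  shows "embeds (edge_set (jump_list E)) (A (Suc k))"
  by (rule embeds_trans[OF isom_imp_embeds[OF isom_sym[OF isom_jmp_edge_set[OF assms(1)]]]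
      embeds_Suc[OF assms(2)]])

lemma isom_jump_list:
  assumes "proper E" "isom (edge_set E) (A k)"
  shows "isom (edge_set (jump_list E)) (A (Suc k))"
  by (rule isom_trans[OF isom_sym[OF isom_jmp_edge_set[OF assms(1)]]
      isom_trans[OF isom_jmp[OF assms(2)] step]])

text \<open>Each jump of the list moves one index ahead in the sequence, and a five-cycle found at
  any index determines \<open>A 0\<close>.\<close>

lemma reaches_five_cycle_sound:
  assumes "reaches_five_cycle m E" "proper E" "embeds (edge_set E) (A k)"
  shows "isom (edge_set five_cycle) (A 0)"
proof -
  have here: "isom (edge_set five_cycle) (A 0)"
    if "embeddable E [] five_cycle" "proper E" "embeds (edge_set E) (A k)" for E k
    using embeds_trans[OF embeddable_sound[OF that(1) proper_five_cycle that(2)] that(3)]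
    by (rule isom_five_cycle)
  show ?thesis
    using assms
  proof (induction m E arbitrary: k rule: reaches_five_cycle.induct)
    case (1 E)
    then show ?case
      using here by simp
  next
    case (2 m E)
    show ?case
    proof (cases "embeddable E [] five_cycle")
      case True
      then show ?thesis
        using here "2.prems" by simp
    next
      case False
      then show ?thesis
        using "2.IH"[OF False _ proper_jump_list embeds_jump_list] "2.prems" by simp
    qed
  qed
qed

text \<open>The iterates of the list would follow the sequence up to isomorphism and vanish at index
  6, but no \<open>A i\<close> is empty.\<close>

lemma mortal_not_isom:
  assumes "S \<in> set mortal_graphs"
  shows "\<not> isom (edge_set S) (A 0)"
proof
  assume "isom (edge_set S) (A 0)"
  then have "proper ((jump_list ^^ i) S) \<and> isom (edge_set ((jump_list ^^ i) S)) (A i)" for i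
    by (induction i) (use assms proper_mortal_graphs in \<open>auto simp: proper_jump_list isom_jump_list\<close>)
  from this[of 6] have "isom (edge_set []) (A 6)"
    using assms mortal_graphs_die by simp
  then show False
    using not_empty[of 6] by (simp add: isom_def)
qed

lemma covered_cases:
  assumes "covered E" "proper E" "embeds (edge_set E) (A 0)"
    and "\<not> isom (edge_set five_cycle) (A 0)" "\<not> isom (edge_set net) (A 0)"
  shows "\<exists>S\<in>set mortal_graphs. length S = length E \<and> embeds (edge_set S) (A 0)"
proof -
  have "\<not> reaches_five_cycle m E" for m
    using reaches_five_cycle_sound[OF _ assms(2,3)] assms(4) by blast
  moreover have "\<not> embeddable E [] net"
    using embeds_trans[OF embeddable_sound[OF _ proper_net assms(2)] assms(3)] isom_net assms(5)
    by blast
  ultimately obtain S where "S \<in> set mortal_graphs" "length S = length E" "embeddable E [] S"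
    using assms(1) by (auto simp: covered_def find_None_iff split: if_splits)
  then show ?thesis
    using embeds_trans[OF embeddable_sound[OF _ _ assms(2)] assms(3)] proper_mortal_graphs by blast
qed

text \<open>An edge of the second jump graph consists of two disjoint edges of the first, each a
  pair of disjoint edges of \<open>A 0\<close>.\<close>

lemma embeds_mortal_graph:
  assumes "\<not> isom (edge_set five_cycle) (A 0)" "\<not> isom (edge_set net) (A 0)"
  shows "\<exists>S\<in>set mortal_graphs. length S = 4 \<and> embeds (edge_set S) (A 0)"
proof -
  have "isom (jmp (jmp (A 0))) (A (Suc (Suc 0)))"
    by (rule isom_trans[OF isom_jmp[OF step] step])
  then have "jmp (jmp (A 0)) \<noteq> {}"
    using not_empty[of "Suc (Suc 0)"] by (auto simp: isom_def)
  then obtain X Y where "X \<in> jmp (A 0)" "Y \<in> jmp (A 0)" and XY: "X \<inter> Y = {}"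
    by (auto simp: jmp_def[of "jmp _"])
  then obtain a b c d where e: "a \<in> A 0" "b \<in> A 0" "c \<in> A 0" "d \<in> A 0" "a \<inter> b = {}" "c \<inter> d = {}"
    and X: "X = {a, b}" "Y = {c, d}"
    by (auto simp: jmp_def)
  have card: "card a = 2" "card b = 2" "card c = 2" "card d = 2"
    using e uniform[of 0] by (auto simp: two_uniform_def)
  \<comment> \<open>The empty list has no vertices to map, so \<open>undefined\<close> serves as its
    embedding.\<close>
  obtain E f where E: "E \<in> set (matched_extensions [])" "proper E"
    "inj_on f (\<Union>(edge_set E))" "(`) f ` edge_set E = {a, b}"
    using embedding_extends_matched[of "[]" undefined a b] card e by (auto simp: proper_def)
  \<comment> \<open>Disjointness of \<open>X\<close> and \<open>Y\<close> keeps the second pair of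
    edges apart from the first.\<close>
  have "c \<notin> (`) f ` edge_set E" "d \<notin> (`) f ` edge_set E"
    using E(4) XY X by auto
  then obtain F g where F: "F \<in> set (matched_extensions E)" "proper F"
    "inj_on g (\<Union>(edge_set F))" "(`) g ` edge_set F = {c, d, a, b}"
    using embedding_extends_matched[OF E(2,3) card(3,4) e(6)] unfolding E(4) by blast
  have "(`) g ` edge_set F \<subseteq> A 0"
    unfolding F(4) using e by simp
  then have "embeds (edge_set F) (A 0)"
    unfolding embeds_def using F(3) by (intro exI conjI)
  moreover have "length F = 4" "covered F"
    using covered_matched_extensions E(1) F(1) by simp_all
  ultimately show ?thesis
    using covered_cases[OF _ F(2) _ assms] by simp
qed

text \<open>A listed graph inside \<open>A 0\<close> is never all of it, so an edge can be added,
  and the result is again covered by the list. This would give listed graphs of every size from four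
  on.\<close>

lemma isom_five_cycle_or_net: "isom (edge_set five_cycle) (A 0) \<or> isom (edge_set net) (A 0)"
proof (rule ccontr)
  assume "\<not> ?thesis"
  then have no: "\<not> isom (edge_set five_cycle) (A 0)" "\<not> isom (edge_set net) (A 0)"
    by simp_all
  have "\<exists>S\<in>set mortal_graphs. length S = 4 + n \<and> embeds (edge_set S) (A 0)" for n
  proof (induction n)
    case 0
    show ?case
      using embeds_mortal_graph[OF no] by simp
  next
    case (Suc n)
    then obtain S where S: "S \<in> set mortal_graphs" "length S = 4 + n" "embeds (edge_set S) (A 0)"
      by blast
    then obtain F where F: "F \<in> set (extensions S)" "proper F" "length F = Suc (length S)"
      "embeds (edge_set F) (A 0)"
      using embeds_extends[OF _ uniform S(3) mortal_not_isom[OF S(1)]] proper_mortal_graphs by blast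
    then have "covered F"
      using covered_extensions S(1) by blast
    then show ?case
      using covered_cases[OF _ F(2,4) no] F(3) S(2) by simp
  qed
  \<comment> \<open>With \<open>n = 3\<close> the graph would have seven edges, one more than the
    list allows.\<close>
  from this[of 3] show False
    using length_mortal_graphs by fastforce
qed

end

section \<open>Return to the iterated jump graph\<close>

lemma isom_edges_jump_iter_Suc:
  assumes "finite_simple_graph G"
  shows "isom (jmp (edges (jump_iter k G))) (edges (jump_iter (Suc k) G))"
proof -
  have "edges (jump_iter (Suc k) G) = (`) (\<lambda>e. Edge (Abs_fset e)) ` jmp (edges (jump_iter k G))"
    by (simp add: relabel_def jump_graph_def jmp_def)
  moreover have "inj_on (\<lambda>e. Edge (Abs_fset e)) (\<Union>(jmp (edges (jump_iter k G))))"
    by (rule inj_on_subset[OF inj_on_Edge_Abs_fset[OF finite_simple_graph_jump_iter[OF assms, of k]]])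
      (simp add: jump_graph_def Union_jmp_subset)
  ultimately show ?thesis
    unfolding isom_def by metis
qed

lemma edges_jump_graph: "edges (jump_graph G) = jmp (edges G)"
  by (simp add: jump_graph_def jmp_def)

lemma isom_edges_jump_iter_0: "isom (edges G) (edges (jump_iter 0 G))"
  unfolding isom_def by (rule exI[of _ Orig]) (simp add: relabel_def inj_on_Orig)

lemma edges_C5: "edges C5 = edge_set five_cycle"
  by (simp add: C5_def five_cycle_def insert_commute)

lemma edges_net_graph: "edges net_graph = edge_set net"
  by (simp add: net_graph_def net_def insert_commute)

lemma finite_simple_graph_C5: "finite_simple_graph C5"
  by (simp add: finite_simple_graph_def C5_def)

lemma finite_simple_graph_net_graph: "finite_simple_graph net_graph"
  by (simp add: finite_simple_graph_def net_graph_def)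

lemma isom_jmp_transfer:
  assumes "isom (jmp C) C" "isom B C"
  shows "isom (jmp B) B"
  by (rule isom_trans[OF isom_jmp[OF assms(2)] isom_trans[OF assms(1) isom_sym[OF assms(2)]]])

theorem mainTheorem3:
  fixes G :: "'a ugraph"
  assumes "finite_simple_graph G"
    and "edges G \<noteq> {}"
  shows "(jump_graph G \<simeq>\<^sub>g G \<longleftrightarrow> (\<exists>k\<ge>1. jump_iter k G \<simeq>\<^sub>g G))
    \<and> ((\<exists>k\<ge>1. jump_iter k G \<simeq>\<^sub>g G) \<longleftrightarrow> (G \<simeq>\<^sub>g C5 \<or> G \<simeq>\<^sub>g net_graph))"
proof -
  have jump: "jump_graph G \<simeq>\<^sub>g G \<longleftrightarrow> isom (jmp (edges G)) (edges G)"
    using graph_eq_iff_isom[OF finite_simple_graph_jump[OF assms(1)] assms(1)]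
    by (simp add: edges_jump_graph)
  have iter: "jump_iter k G \<simeq>\<^sub>g G \<longleftrightarrow> isom (edges (jump_iter k G)) (edges G)" for k
    by (rule graph_eq_iff_isom[OF finite_simple_graph_jump_iter[OF assms(1)] assms(1)])
  have C5: "G \<simeq>\<^sub>g C5 \<longleftrightarrow> isom (edges G) (edge_set five_cycle)"
    using graph_eq_iff_isom[OF assms(1) finite_simple_graph_C5] by (simp add: edges_C5)
  have N: "G \<simeq>\<^sub>g net_graph \<longleftrightarrow> isom (edges G) (edge_set net)"
    using graph_eq_iff_isom[OF assms(1) finite_simple_graph_net_graph] by (simp add: edges_net_graph)
  \<comment> \<open>The witness is \<open>k = 1\<close>: \<open>jump_iter 1 G\<close> is
    \<open>jump_graph G\<close> up to relabelling.\<close>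
  have "jump_iter 1 G \<simeq>\<^sub>g G" if "jump_graph G \<simeq>\<^sub>g G"
  proof -
    have "isom (jmp (edges G)) (edges (jump_iter 1 G))"
      using isom_trans[OF isom_jmp[OF isom_edges_jump_iter_0] isom_edges_jump_iter_Suc[OF assms(1)]]
      by simp
    then show ?thesis
      using that unfolding jump iter by (rule isom_trans[OF isom_sym])
  qed
  moreover have "G \<simeq>\<^sub>g C5 \<or> G \<simeq>\<^sub>g net_graph" if p: "p \<ge> 1" "jump_iter p G \<simeq>\<^sub>g G" for p
  proof -
    interpret periodic_jump "\<lambda>k. edges (jump_iter k G)" p
    proof
      show "two_uniform (edges (jump_iter k G))" for k
        by (rule two_uniform_edges[OF finite_simple_graph_jump_iter[OF assms(1)]])
      show "isom (jmp (edges (jump_iter k G))) (edges (jump_iter (Suc k) G))" for k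
        by (rule isom_edges_jump_iter_Suc[OF assms(1)])
      show "isom (edges (jump_iter p G)) (edges (jump_iter 0 G))"
        by (rule isom_trans[OF _ isom_edges_jump_iter_0]) (use p iter in simp)
      show "p > 0"
        using p by simp
      show "edges (jump_iter 0 G) \<noteq> {}"
        using assms(2) by (simp add: relabel_def)
    qed
    show ?thesis
      unfolding C5 N using isom_five_cycle_or_net
      by (metis isom_trans[OF isom_edges_jump_iter_0] isom_sym)
  qed
  moreover have "jump_graph G \<simeq>\<^sub>g G" if "G \<simeq>\<^sub>g C5 \<or> G \<simeq>\<^sub>g net_graph"
    using that isom_jmp_transfer[OF isom_jmp_five_cycle] isom_jmp_transfer[OF isom_jmp_net]
    unfolding jump C5 N by blast
  ultimately show ?thesis
    by blast
qed

end
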